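(* Let $f:\mathbb{R}^d\to\mathbb{R}$ be a locally smooth convex function having a minimizer $x_\star$, and let $f_\star=f(x_\star)$. Let $\{x_k\},\{y_k\},\{z_k\},\{s_k\},\{L_k\}$ be generated by AdaNAG (defined in the context) with any $x_0=z_0\in\mathbb{R}^d$ and $s_0>0$. Put $\tilde\alpha_0=\frac12\left(1-\frac1{\theta_2}\right)$ and, for $k\ge0$, $$A_k=\alpha_{k+1}\theta_{k+3}(\theta_{k+3}-1),\qquad B_0=\tilde\alpha_0\alpha_0\theta_2^2,\qquad B_k=\alpha_k^2\theta_{k+2}^2\ (k\ge1),$$ $$V_k=s_{k+1}A_k\,(f(x_k)-f_\star)+\frac12 s_k^2B_k\|\nabla f(x_k)\|^2+\frac12\|z_{k+1}-x_\star\|^2 .$$ Then for all $k\ge0$, $$V_{k+1}-V_k\le-\frac12\min\left\{s_k^2B_k,\ \frac{s_{k+1}}{L_{k+1}}A_k\right\}\|\nabla f(x_k)\|^2\le0 .$$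
   Context: $f$ is locally smooth if it is differentiable and $\nabla f$ is Lipschitz on every compact subset of $\mathbb{R}^d$. $\|\cdot\|$ is the Euclidean norm. AdaNAG. Define $\theta_0=1$, $\theta_k=\frac12\left(1+\sqrt{1+4\theta_{k-1}^2}\right)$ for $k\ge1$; $\alpha_k=\frac12\left(1-\frac1{\theta_{k+2}}\right)$ for $k\ge1$, and $\alpha_0=\frac{2\theta_2}{\theta_2-1}\left(\frac1{\alpha_3}+\frac1{\alpha_2^2}-\frac1{\alpha_1}\right)^{-1}$. Given $x_0=z_0\in\mathbb{R}^d$ and $s_0>0$, for $k=0,1,2,\dots$: $$y_{k+1}=x_k-s_k\nabla f(x_k),\quad z_{k+1}=z_k-s_k\alpha_k\theta_{k+2}\nabla f(x_k),\quad x_{k+1}=\left(1-\tfrac1{\theta_{k+3}}\right)y_{k+1}+\tfrac1{\theta_{k+3}}z_{k+1},$$ $$L_{k+1}=-\frac{\frac12\|\nabla f(x_{k+1})-\nabla f(x_k)\|^2}{f(x_{k+1})-f(x_k)+\langle\nabla f(x_{k+1}),x_k-x_{k+1}\rangle},$$ $$s_1=\min\left\{\frac{\alpha_0}{\alpha_1}\frac{\theta_2}{\theta_3(\theta_3-1)}s_0,\ \frac{\alpha_2^2\alpha_3}{\alpha_3+\alpha_2^2}\frac1{\alpha_1}\frac1{L_1}\right\},\qquad s_{k+1}=\min\left\{\frac{\alpha_k}{\alpha_{k+1}}s_k,\ \frac{\alpha_k^2}{\alpha_{k+1}+\alpha_k^2}\frac1{L_{k+1}}\right\}\ (k\ge1).$$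 Conventions: $\frac00=0$ and $\frac a0=+\infty$ for $a>0$ (so $L_{k+1}=0$ when its numerator and denominator both vanish, and then $1/L_{k+1}=+\infty$). *)

theory Defs
  imports "HOL-Analysis.Analysis"
begin

text \<open>The gradient is unique where it exists; it is only meaningful at points of
  differentiability.\<close>

definition gradient :: "('a::real_inner \<Rightarrow> real) \<Rightarrow> 'a \<Rightarrow> 'a" where
  "gradient f x = (THE D. GDERIV f x :> D)"

definition locally_smooth :: "('a::real_inner \<Rightarrow> real) \<Rightarrow> bool" where
  "locally_smooth f \<longleftrightarrow> (\<forall>x. f differentiable (at x)) \<and>
     (\<forall>K. compact K \<longrightarrow> (\<exists>C. C-lipschitz_on K (gradient f)))"

fun theta :: "nat \<Rightarrow> real" where
  "theta 0 = 1"
| "theta (Suc k) = 1/2 * (1 + sqrt (1 + 4 * (theta k)\<^sup>2))"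

text \<open>The sequence \<open>alpha_tilde\<close> is given by one formula for all indices; \<open>alpha\<close> agrees
  with it except at index \<open>0\<close>.\<close>

definition alpha_tilde :: "nat \<Rightarrow> real" where
  "alpha_tilde k = 1/2 * (1 - 1 / theta (k+2))"

definition alpha :: "nat \<Rightarrow> real" where
  "alpha k =
     (if k = 0
      then 2 * theta 2 / (theta 2 - 1)
             * inverse (1 / alpha_tilde 3 + 1 / (alpha_tilde 2)\<^sup>2 - 1 / alpha_tilde 1)
      else alpha_tilde k)"

text \<open>Extended-real division satisfies \<open>0 / 0 = 0\<close> and \<open>a / 0 = \<infinity>\<close> for \<open>a > 0\<close>, so
  the quotients below and \<open>1 / L\<close> need no case distinction. For convex differentiable \<open>f\<close>
  the denominator can vanish only together with the numerator.\<close>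

definition local_curvature :: "('a::real_inner \<Rightarrow> real) \<Rightarrow> 'a \<Rightarrow> 'a \<Rightarrow> ereal" where
  "local_curvature f u v =
     - (ereal (1/2 * (norm (gradient f v - gradient f u))\<^sup>2)
        / ereal (f v - f u + gradient f v \<bullet> (u - v)))"

text \<open>The values \<open>y 0\<close> and \<open>L 0\<close> do not occur in the algorithm and are left unconstrained.
  Each minimum in the step-size rule has a finite first argument, and its second argument is
  never \<open>-\<infinity>\<close>, so it is the embedding of a real number.\<close>

definition AdaNAG ::
  "('a::real_inner \<Rightarrow> real) \<Rightarrow> (nat \<Rightarrow> 'a) \<Rightarrow> (nat \<Rightarrow> 'a) \<Rightarrow> (nat \<Rightarrow> 'a)
     \<Rightarrow> (nat \<Rightarrow> real) \<Rightarrow> (nat \<Rightarrow> ereal) \<Rightarrow> bool" where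
  "AdaNAG f x y z s L \<longleftrightarrow>
     x 0 = z 0 \<and> s 0 > 0 \<and>
     (\<forall>k. y (k+1) = x k - s k *\<^sub>R gradient f (x k)) \<and>
     (\<forall>k. z (k+1) = z k - (s k * alpha k * theta (k+2)) *\<^sub>R gradient f (x k)) \<and>
     (\<forall>k. x (k+1) = (1 - 1 / theta (k+3)) *\<^sub>R y (k+1) + (1 / theta (k+3)) *\<^sub>R z (k+1)) \<and>
     (\<forall>k. L (k+1) = local_curvature f (x k) (x (k+1))) \<and>
     ereal (s 1) =
       min (ereal (alpha 0 / alpha 1 * (theta 2 / (theta 3 * (theta 3 - 1))) * s 0))
           (ereal ((alpha 2)\<^sup>2 * alpha 3 / (alpha 3 + (alpha 2)\<^sup>2) * (1 / alpha 1)) * (1 / L 1)) \<and>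
     (\<forall>k\<ge>1. ereal (s (k+1)) =
       min (ereal (alpha k / alpha (k+1) * s k))
           (ereal ((alpha k)\<^sup>2 / (alpha (k+1) + (alpha k)\<^sup>2)) * (1 / L (k+1))))"

text \<open>The relation \<open>AdaNAG\<close> is satisfiable for every starting point and every
  positive initial step size.\<close>

lemma theta_ge_1: "theta k \<ge> 1"
  by (induction k) auto

lemma theta_Suc_gt_1: "theta (Suc k) > 1"
proof -
  have "1 < sqrt (1 + 4 * (theta k)\<^sup>2)" using theta_ge_1[of k] by simp
  then show ?thesis by simp
qed

lemma alpha_tilde_pos: "alpha_tilde k > 0"
proof -
  have "theta (k+2) > 1" using theta_Suc_gt_1[of "Suc k"] by (simp only: add_2_eq_Suc')
  then show ?thesis by (simp add: alpha_tilde_def del: theta.simps)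
qed

lemma alpha_pos: "k > 0 \<Longrightarrow> alpha k > 0" using alpha_tilde_pos[of k] by (simp add: alpha_def)

lemma inverse_ereal_not_MInf: "1 / (l::ereal) \<noteq> -\<infinity>"
  by (cases l) (auto simp: divide_ereal_def one_ereal_def)

lemma min_step_real: "c > 0 \<Longrightarrow> ereal (real_of_ereal (min (ereal a) (ereal c * (1 / l)))) = min (ereal a) (ereal c * (1 / l))"
proof -
  assume c: "c > 0"
  have n: "ereal c * (1/l) \<noteq> -\<infinity>" using c inverse_ereal_not_MInf[of l] by (cases "1/l") auto
  define t where "t = ereal c * (1 / l)"
  show ?thesis using n unfolding t_def[symmetric] by (cases t) (auto simp: min_def)
qed

lemma AdaNAG_exists:
  fixes f :: "'a::real_inner \<Rightarrow> real"
  assumes "s0 > 0"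
  shows "\<exists>x y z s L. AdaNAG f x y z s L \<and> x 0 = x0 \<and> s 0 = s0"
proof -
  define Y where "Y u s = u - s *\<^sub>R gradient f u" for u and s::real
  define Z where "Z k u w s = w - (s * alpha k * theta (k+2)) *\<^sub>R gradient f u" for k u w and s::real
  define X where "X k u w s = (1 - 1 / theta (k+3)) *\<^sub>R Y u s + (1 / theta (k+3)) *\<^sub>R Z k u w s" for k u w and s::real
  define S where "S k l s = real_of_ereal (if k = 0 then min (ereal (alpha 0 / alpha 1 * (theta 2 / (theta 3 * (theta 3 - 1))) * s))
           (ereal ((alpha 2)\<^sup>2 * alpha 3 / (alpha 3 + (alpha 2)\<^sup>2) * (1 / alpha 1)) * (1 / l))
     else min (ereal (alpha k / alpha (k+1) * s))
           (ereal ((alpha k)\<^sup>2 / (alpha (k+1) + (alpha k)\<^sup>2)) * (1 / l)))" for k::nat and l::ereal and s::real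
  define st where "st = rec_nat (x0,x0,s0) (\<lambda>k (u,w,s). (X k u w s, Z k u w s, S k (local_curvature f u (X k u w s)) s))"
  define x where "x k = fst (st k)" for k
  define z where "z k = fst (snd (st k))" for k
  define s where "s k = snd (snd (st k))" for k
  define y where "y k = Y (x (k-1)) (s (k-1))" for k
  define L where "L k = local_curvature f (x (k-1)) (x k)" for k
  have xS: "x (Suc k) = X k (x k) (z k) (s k)" for k by (simp add: x_def z_def s_def st_def split: prod.split)
  have zS: "z (Suc k) = Z k (x k) (z k) (s k)" for k by (simp add: x_def z_def s_def st_def split: prod.split)
  have sS: "s (Suc k) = S k (L (Suc k)) (s k)" for k by (simp add: L_def x_def z_def s_def st_def split: prod.split)
  have i: "x 0 = x0" "z 0 = x0" "s 0 = s0" by (simp_all add: x_def z_def s_def st_def)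
  have "AdaNAG f x y z s L" unfolding AdaNAG_def
  proof (intro conjI allI impI)
    show "x 0 = z 0" "s 0 > 0" using i assms by auto
    show "y (k+1) = x k - s k *\<^sub>R gradient f (x k)" for k by (simp add: y_def Y_def)
    show "z (k+1) = z k - (s k * alpha k * theta (k+2)) *\<^sub>R gradient f (x k)" for k
      unfolding Suc_eq_plus1[symmetric] zS Z_def by simp
    show "x (k+1) = (1 - 1 / theta (k+3)) *\<^sub>R y (k+1) + (1 / theta (k+3)) *\<^sub>R z (k+1)" for k
      unfolding Suc_eq_plus1[symmetric] xS zS X_def by (simp add: y_def)
    show "L (k+1) = local_curvature f (x k) (x (k+1))" for k by (simp add: L_def)
    have c: "(alpha 2)\<^sup>2 * alpha 3 / (alpha 3 + (alpha 2)\<^sup>2) * (1 / alpha 1) > 0"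
      using alpha_pos[of 1] alpha_pos[of 2] alpha_pos[of 3] by (simp add: add_pos_pos)
    show "ereal (s 1) =
       min (ereal (alpha 0 / alpha 1 * (theta 2 / (theta 3 * (theta 3 - 1))) * s 0))
           (ereal ((alpha 2)\<^sup>2 * alpha 3 / (alpha 3 + (alpha 2)\<^sup>2) * (1 / alpha 1)) * (1 / L 1))"
      using sS[of 0] min_step_real[OF c] by (simp add: S_def)
    show "ereal (s (k+1)) =
       min (ereal (alpha k / alpha (k+1) * s k))
           (ereal ((alpha k)\<^sup>2 / (alpha (k+1) + (alpha k)\<^sup>2)) * (1 / L (k+1)))" if "k \<ge> 1" for k
    proof -
      have c: "(alpha k)\<^sup>2 / (alpha (k+1) + (alpha k)\<^sup>2) > 0" using alpha_pos[of k] alpha_pos[of "k+1"] that by (simp add: add_pos_pos)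
      show ?thesis using sS[of k] min_step_real[OF c] that by (simp add: S_def)
    qed
  qed
  then show ?thesis using i by blast
qed

definition A_coeff :: "nat \<Rightarrow> real" where
  "A_coeff k = alpha (k+1) * theta (k+3) * (theta (k+3) - 1)"

definition B_coeff :: "nat \<Rightarrow> real" where
  "B_coeff k =
     (if k = 0 then alpha_tilde 0 * alpha 0 * (theta 2)\<^sup>2
      else (alpha k)\<^sup>2 * (theta (k+2))\<^sup>2)"

definition lyapunov ::
  "('a::real_inner \<Rightarrow> real) \<Rightarrow> 'a \<Rightarrow> (nat \<Rightarrow> 'a) \<Rightarrow> (nat \<Rightarrow> 'a) \<Rightarrow> (nat \<Rightarrow> real) \<Rightarrow> nat \<Rightarrow> real" where
  "lyapunov f xstar x z s k =
     s (k+1) * A_coeff k * (f (x k) - f xstar)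
     + 1/2 * (s k)\<^sup>2 * B_coeff k * (norm (gradient f (x k)))\<^sup>2
     + 1/2 * (norm (z (k+1) - xstar))\<^sup>2"

end

theory Submission
  imports Defs
begin

text \<open>Since \<open>z\<^sub>k\<^sub>+\<^sub>1 = x\<^sub>k\<^sub>+\<^sub>1 + (\<theta>\<^sub>k\<^sub>+\<^sub>3 - 1) (x\<^sub>k\<^sub>+\<^sub>1 - x\<^sub>k + s\<^sub>k g\<^sub>k)\<close>, where \<open>g\<^sub>k\<close> is the
  gradient at \<open>x\<^sub>k\<close>, expanding the squared distance of \<open>z\<close> to the minimizer and using convexity
  removes all function values from the increment of \<open>V\<close>: their coefficient is nonpositive by
  \<open>s\<^sub>k\<^sub>+\<^sub>2 \<alpha>\<^sub>k\<^sub>+\<^sub>2 \<le> s\<^sub>k\<^sub>+\<^sub>1 \<alpha>\<^sub>k\<^sub>+\<^sub>1\<close> and \<open>\<theta>\<^sub>k\<^sub>+\<^sub>1 (\<theta>\<^sub>k\<^sub>+\<^sub>1 - 1) = \<theta>\<^sub>k\<^sup>2\<close>. What is left is a quadratic form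
  in \<open>g\<^sub>k\<close> and \<open>g\<^sub>k\<^sub>+\<^sub>1\<close>, because the convexity gap equals \<open>\<parallel>g\<^sub>k\<^sub>+\<^sub>1 - g\<^sub>k\<parallel>\<^sup>2 / (2 L\<^sub>k\<^sub>+\<^sub>1)\<close>. Its discriminant
  has the right sign by \<open>s\<^sub>k\<^sub>+\<^sub>1 \<le> s\<^sub>k\<close> and the curvature bound on \<open>s\<^sub>k\<^sub>+\<^sub>1\<close>. The constant \<open>\<alpha>\<^sub>0\<close> is
  chosen so that the first step obeys the same rule as the others, with \<open>\<alpha>\<^sub>k\<^sup>2\<close> replaced
  by \<open>weight 0\<close>; that \<open>s\<^sub>1 \<le> s\<^sub>0\<close> is a numerical check.\<close>

section \<open>Gradients and local curvature of convex functions\<close>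

lemma GDERIV_gradient:
  fixes f :: "'a::euclidean_space \<Rightarrow> real"
  assumes "f differentiable (at x)"
  shows "GDERIV f x :> gradient f x"
proof -
  obtain F where F: "(f has_derivative F) (at x)"
    using assms by (auto simp: differentiable_def)
  \<comment> \<open>Riesz representation in finite dimension: the vector representing the functional
    \<open>F\<close> is \<open>adjoint F 1\<close>.\<close>
  have "F = (\<lambda>h. h \<bullet> adjoint F 1)"
    using adjoint_works[OF has_derivative_linear[OF F], of _ 1] by auto
  with F have G: "GDERIV f x :> adjoint F 1" by (simp add: gderiv_def)
  moreover have "D = adjoint F 1" if "GDERIV f x :> D" for D
  proof -
    have "(\<lambda>h. h \<bullet> D) = (\<lambda>h. h \<bullet> adjoint F 1)"
      using that G has_derivative_unique unfolding gderiv_def by blast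
    then have "h \<bullet> D = h \<bullet> adjoint F 1" for h by meson
    then show ?thesis using vector_eq_rdot by (metis inner_commute)
  qed
  ultimately show ?thesis unfolding gradient_def by (rule theI)
qed

text \<open>Restricting \<open>f\<close> to the line through \<open>v\<close> and \<open>u\<close>
  reduces this to the tangent bound for convex functions of one real variable.\<close>

lemma convex_gradient_inequality:
  fixes f :: "'a::euclidean_space \<Rightarrow> real"
  assumes "f differentiable (at v)" "convex_on UNIV f"
  shows "f v + gradient f v \<bullet> (u - v) \<le> f u"
proof -
  define \<phi> where "\<phi> t = f (v + t *\<^sub>R (u - v))" for t :: real
  have "convex_on UNIV \<phi>"
  proof (rule convex_onI)
    fix t a b :: real
    assume t: "0 < t" "t < 1"
    have "v + ((1 - t) *\<^sub>R a + t *\<^sub>R b) *\<^sub>R (u - v)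
        = (1 - t) *\<^sub>R (v + a *\<^sub>R (u - v)) + t *\<^sub>R (v + b *\<^sub>R (u - v))"
      by (simp add: algebra_simps)
    with convex_onD[OF assms(2), of t] t
    show "\<phi> ((1 - t) *\<^sub>R a + t *\<^sub>R b) \<le> (1 - t) * \<phi> a + t * \<phi> b"
      unfolding \<phi>_def by simp
  qed simp
  moreover have "(\<phi> has_real_derivative (gradient f v \<bullet> (u - v))) (at 0 within UNIV)"
  proof -
    have "(f has_derivative (\<lambda>h. h \<bullet> gradient f v)) (at (v + 0 *\<^sub>R (u - v)))"
      using GDERIV_gradient[OF assms(1)] by (simp add: gderiv_def)
    moreover have "((\<lambda>t. v + t *\<^sub>R (u - v)) has_derivative (\<lambda>t. t *\<^sub>R (u - v))) (at (0::real))"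
      by (auto intro!: derivative_eq_intros)
    ultimately show ?thesis
      unfolding has_field_derivative_def \<phi>_def
      by (auto dest!: has_derivative_compose simp: inner_commute mult.commute fun_eq_iff
          elim!: has_derivative_eq_rhs)
  qed
  ultimately have "\<phi> 1 - \<phi> 0 \<ge> gradient f v \<bullet> (u - v) * (1 - 0)"
    by (intro convex_on_imp_above_tangent) auto
  then show ?thesis by (simp add: \<phi>_def)
qed

text \<open>Subtracting the linear functional given by \<open>gradient f v\<close> from
  \<open>f\<close> leaves a function that, by the assumed equality, is minimal at \<open>u\<close>;
  hence its derivative there vanishes.\<close>

lemma convex_gradient_eqI:
  fixes f :: "'a::euclidean_space \<Rightarrow> real"
  assumes "f differentiable (at u)" "f differentiable (at v)" "convex_on UNIV f"
    and "f v + gradient f v \<bullet> (u - v) = f u"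
  shows "gradient f v = gradient f u"
proof -
  define h where "h w = f w - w \<bullet> gradient f v" for w
  have min: "h u \<le> h w" for w
    using convex_gradient_inequality[OF assms(2,3), of w] assms(4)
    by (simp add: h_def inner_commute algebra_simps)
  have "(h has_derivative (\<lambda>d. d \<bullet> gradient f u - d \<bullet> gradient f v)) (at u)"
    using GDERIV_gradient[OF assms(1)] unfolding h_def gderiv_def
    by (auto intro!: derivative_eq_intros)
  from has_derivative_local_min[OF this] min
  have "d \<bullet> gradient f u - d \<bullet> gradient f v = 0" for d
    by (auto simp: fun_eq_iff)
  then show ?thesis by (metis eq_iff_diff_eq_0 inner_commute vector_eq_rdot)
qed

text \<open>By convexity the denominator is at most zero, and by \<open>convex_gradient_eqI\<close>
  it vanishes only if the gradients agree. The extended-real quotient thus has two outcomes, and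
  later arguments can work with real numbers.\<close>

lemma local_curvature_cases:
  fixes f :: "'a::euclidean_space \<Rightarrow> real"
  assumes "\<And>w. f differentiable (at w)" "convex_on UNIV f"
  obtains "local_curvature f u v = 0" "gradient f v = gradient f u"
  | r where "r > 0" "local_curvature f u v = ereal r"
      "f u - f v - gradient f v \<bullet> (u - v) = 1 / r * (1/2 * (norm (gradient f v - gradient f u))\<^sup>2)"
proof -
  define D where "D = f v - f u + gradient f v \<bullet> (u - v)"
  define N where "N = 1/2 * (norm (gradient f v - gradient f u))\<^sup>2"
  have L: "local_curvature f u v = - (ereal N / ereal D)"
    by (simp add: local_curvature_def D_def N_def)
  have "D \<le> 0" using convex_gradient_inequality[of f v u] assms by (simp add: D_def)
  show thesis
  proof (cases "N = 0")
    case True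
    then show thesis using that(1) L by (simp add: N_def)
  next
    case False
    then have "N > 0" by (simp add: N_def)
    have "D \<noteq> 0"
    proof
      assume "D = 0"
      then have "gradient f v = gradient f u"
        using convex_gradient_eqI[of f u v] assms by (simp add: D_def)
      with False show False by (simp add: N_def)
    qed
    with \<open>D \<le> 0\<close> have "D < 0" by simp
    show thesis
    proof (rule that(2))
      show "N / - D > 0" using \<open>N > 0\<close> \<open>D < 0\<close> by (simp add: divide_pos_neg)
      show "local_curvature f u v = ereal (N / - D)" using L \<open>D < 0\<close> by simp
      have "f u - f v - gradient f v \<bullet> (u - v) = - D" by (simp add: D_def)
      also have "\<dots> = 1 / (N / - D) * N" using \<open>N > 0\<close> \<open>D < 0\<close> by (simp add: field_simps)
      finally show "f u - f v - gradient f v \<bullet> (u - v)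
          = 1 / (N / - D) * (1/2 * (norm (gradient f v - gradient f u))\<^sup>2)"
        unfolding N_def .
    qed
  qed
qed

section \<open>Bounds on \<open>theta\<close> and \<open>alpha\<close>, and the constant
  \<open>weight 0\<close>\<close>

declare theta.simps(2) [simp del]

text \<open>Isolating and squaring the root in the recursion turns the propagation of a rational
  bound \<open>c\<close> into rational arithmetic.\<close>

lemma theta_Suc_lower:
  assumes "0 \<le> 2 * a - 1" "(2 * a - 1)\<^sup>2 \<le> 1 + 4 * c\<^sup>2" "0 \<le> c" "c \<le> theta k"
  shows "a \<le> theta (Suc k)"
proof -
  have "c\<^sup>2 \<le> (theta k)\<^sup>2" using assms by (intro power_mono) auto
  then have "2 * a - 1 \<le> sqrt (1 + 4 * (theta k)\<^sup>2)"
    using assms by (intro real_le_rsqrt) linarith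
  then show ?thesis by (simp add: theta.simps(2))
qed

lemma theta_Suc_upper:
  assumes "0 \<le> 2 * a - 1" "1 + 4 * c\<^sup>2 \<le> (2 * a - 1)\<^sup>2" "theta k \<le> c"
  shows "theta (Suc k) \<le> a"
proof -
  have "(theta k)\<^sup>2 \<le> c\<^sup>2" using assms theta_ge_1[of k] by (intro power_mono) auto
  then have "sqrt (1 + 4 * (theta k)\<^sup>2) \<le> 2 * a - 1"
    using assms by (intro real_le_lsqrt) auto
  then show ?thesis by (simp add: theta.simps(2))
qed

lemma theta_Suc_quadratic: "theta (Suc k) * (theta (Suc k) - 1) = (theta k)\<^sup>2"
proof -
  have "(sqrt (1 + 4 * (theta k)\<^sup>2))\<^sup>2 = 1 + 4 * (theta k)\<^sup>2" by simp
  then show ?thesis by (simp add: theta.simps(2) power2_eq_square field_simps)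
qed

lemma theta_mono: "theta k \<le> theta (Suc k)"
proof -
  have "2 * theta k \<le> sqrt (1 + 4 * (theta k)\<^sup>2)"
    by (rule real_le_rsqrt) (simp add: power_mult_distrib)
  then show ?thesis by (simp add: theta.simps(2))
qed

lemma alpha_tilde_mono: "alpha_tilde k \<le> alpha_tilde (Suc k)"
  using theta_mono[of "k+2"] theta_ge_1[of "k+2"]
  by (simp add: alpha_tilde_def frac_le)

text \<open>These bounds control \<open>alpha_tilde\<close> at 0, 1 and 2, the index of
  \<open>theta\<close> being shifted by two. The upper bounds are propagated values rounded
  upward.\<close>

lemma theta_numeric_bounds: "2 \<le> theta 2" "5/2 \<le> theta 3" "theta 4 \<le> 331/100"
proof -
  have l: "3/2 \<le> theta 1" using theta_Suc_lower[of "3/2" 1 0] by (simp add: power2_eq_square)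
  have u1: "theta 1 \<le> 81/50" using theta_Suc_upper[of "81/50" 1 0] by (simp add: power2_eq_square)
  show l2: "2 \<le> theta 2"
    using theta_Suc_lower[of 2 "3/2" 1] l by (simp add: power2_eq_square numeral_2_eq_2)
  show "5/2 \<le> theta 3"
    using theta_Suc_lower[of "5/2" 2 2] l2 by (simp add: power2_eq_square eval_nat_numeral)
  have u2: "theta 2 \<le> 11/5"
    using theta_Suc_upper[of "11/5" "81/50" 1] u1 by (simp add: power2_eq_square numeral_2_eq_2)
  have u3: "theta 3 \<le> 69/25"
    using theta_Suc_upper[of "69/25" "11/5" 2] u2 by (simp add: power2_eq_square eval_nat_numeral)
  show "theta 4 \<le> 331/100"
    using theta_Suc_upper[of "331/100" "69/25" 3] u3 by (simp add: power2_eq_square eval_nat_numeral)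
qed

lemma alpha_eq_tilde: "0 < k \<Longrightarrow> alpha k = alpha_tilde k"
  by (simp add: alpha_def)

text \<open>The factor of \<open>B_coeff k\<close> that remains after
  \<open>(theta (k+2))\<^sup>2\<close> is split off.\<close>

definition weight :: "nat \<Rightarrow> real" where
  "weight k = (if k = 0 then alpha_tilde 0 * alpha 0 else (alpha k)\<^sup>2)"

text \<open>The prefactor of the inverse in \<open>alpha 0\<close> is exactly the reciprocal of
  \<open>alpha_tilde 0\<close>.\<close>

lemma weight_0_eq:
  "weight 0 = inverse (1 / alpha_tilde 3 + 1 / (alpha_tilde 2)\<^sup>2 - 1 / alpha_tilde 1)"
proof -
  have "alpha_tilde 0 * (2 * theta 2 / (theta 2 - 1)) = 1"
    using theta_numeric_bounds(1) by (simp add: alpha_tilde_def[of 0] field_simps numeral_2_eq_2)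
  moreover have "weight 0 = alpha_tilde 0 * (2 * theta 2 / (theta 2 - 1))
      * inverse (1 / alpha_tilde 3 + 1 / (alpha_tilde 2)\<^sup>2 - 1 / alpha_tilde 1)"
    by (simp add: weight_def alpha_def mult.assoc)
  ultimately show ?thesis by (simp only: mult_1_left)
qed

text \<open>Dividing the upper bound by \<open>alpha_tilde 0\<close> bounds \<open>alpha 0\<close>,
  which is what makes the first step ratio at most 1.\<close>

lemma weight_0_bounds: "0 < weight 0" "weight 0 \<le> alpha_tilde 0 * (alpha_tilde 1 * theta 2)"
proof -
  have a1: "3/10 \<le> alpha_tilde 1"
    using theta_numeric_bounds(2) by (simp add: alpha_tilde_def field_simps numeral_3_eq_3)
  have a2: "alpha_tilde 2 \<le> 349/1000"
  proof -
    have "100/331 \<le> 1 / theta 4" using theta_numeric_bounds(3) theta_ge_1[of 4] by (simp add: field_simps)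
    then show ?thesis by (simp add: alpha_tilde_def)
  qed
  have a3: "alpha_tilde 3 \<le> 1/2" using theta_ge_1[of 5] by (simp add: alpha_tilde_def)
  have "(alpha_tilde 2)\<^sup>2 \<le> (349/1000)\<^sup>2"
    using a2 alpha_tilde_pos[of 2] by (intro power_mono) auto
  then have "82/10 \<le> 1 / (alpha_tilde 2)\<^sup>2"
    using alpha_tilde_pos[of 2] by (simp add: field_simps power2_eq_square)
  moreover have "2 \<le> 1 / alpha_tilde 3" using a3 alpha_tilde_pos[of 3] by (simp add: field_simps)
  moreover have "1 / alpha_tilde 1 \<le> 10/3" using a1 by (simp add: field_simps)
  \<comment> \<open>The threshold is chosen because its inverse 3/20 equals 1/2 * 3/10, a lower
    bound for \<open>(theta 2 - 1) / 2 * alpha_tilde 1\<close>.\<close>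
  ultimately have *: "20/3 \<le> 1 / alpha_tilde 3 + 1 / (alpha_tilde 2)\<^sup>2 - 1 / alpha_tilde 1"
    by linarith
  then show "0 < weight 0" unfolding weight_0_eq by simp
  have "weight 0 \<le> inverse (20/3)" unfolding weight_0_eq using * by (intro le_imp_inverse_le) auto
  also have "\<dots> \<le> 1/2 * (3/10)" by simp
  also have "\<dots> \<le> (theta 2 - 1) / 2 * alpha_tilde 1"
    using theta_numeric_bounds(1) a1 by (intro mult_mono) auto
  also have "\<dots> = alpha_tilde 0 * (alpha_tilde 1 * theta 2)"
    using theta_numeric_bounds(1) by (simp add: alpha_tilde_def[of 0] field_simps numeral_2_eq_2)
  finally show "weight 0 \<le> alpha_tilde 0 * (alpha_tilde 1 * theta 2)" .
qed

lemma weight_pos: "0 < weight k"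
  using weight_0_bounds(1) alpha_pos[of k] by (cases "k = 0") (auto simp: weight_def)

lemma alpha_0_bounds: "0 < alpha 0" "alpha 0 \<le> alpha_tilde 1 * theta 2"
  using weight_0_bounds alpha_tilde_pos[of 0] by (auto simp: weight_def zero_less_mult_iff)

lemma alpha_pos_all: "0 < alpha k"
  using alpha_0_bounds(1) alpha_pos[of k] by (cases "k = 0") auto

section \<open>Quadratic forms in two gradients\<close>

lemma quadratic_form_le:
  fixes g h :: "'a::real_inner"
  assumes "P > 0" "R\<^sup>2 \<le> P * Q"
  shows "2 * R * (g \<bullet> h) \<le> P * (norm g)\<^sup>2 + Q * (norm h)\<^sup>2"
proof -
  have "0 \<le> (norm (P *\<^sub>R g - R *\<^sub>R h))\<^sup>2" by simp
  also have "\<dots> = P * (P * (norm g)\<^sup>2 - 2 * R * (g \<bullet> h)) + R\<^sup>2 * (norm h)\<^sup>2"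
    unfolding power2_norm_eq_inner
    by (simp add: inner_diff inner_commute algebra_simps power2_eq_square)
  also have "\<dots> \<le> P * (P * (norm g)\<^sup>2 - 2 * R * (g \<bullet> h)) + P * Q * (norm h)\<^sup>2"
    using assms(2) by (simp add: mult_right_mono)
  also have "\<dots> = P * (P * (norm g)\<^sup>2 + Q * (norm h)\<^sup>2 - 2 * R * (g \<bullet> h))"
    by (simp add: algebra_simps)
  finally show ?thesis using assms(1) by (simp add: zero_le_mult_iff)
qed

text \<open>Here \<open>t\<close> is the new step size, \<open>s\<close> the old one and \<open>l\<close> the inverse of the local curvature.\<close>

lemma step_size_discriminant:
  fixes a b l s t :: real
  assumes "0 < a" "0 < b" "0 < l" "0 < t" "t \<le> s" "t * (a + b) \<le> b * l"
  shows "t * a * (l - s)\<^sup>2 \<le> max (s\<^sup>2 * b) (t * a * l) * (l - t)"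
proof -
  have tb: "t * a \<le> b * (l - t)" using assms by (simp add: algebra_simps)
  then have lt: "0 \<le> l - t" using assms by (smt (verit) mult_pos_pos mult_neg_pos mult_pos_neg)
  \<comment> \<open>The cases decide which entry of the maximum is used. For
    \<open>l \<le> 2 * s\<close>, \<open>(l - s)\<^sup>2\<close> is at most \<open>s\<^sup>2\<close>
    and \<open>tb\<close> applies; otherwise \<open>t \<le> s\<close> bounds it by
    \<open>l * (l - t)\<close>.\<close>
  show ?thesis
  proof (cases "l \<le> 2 * s")
    case True
    have "t * a * (l - s)\<^sup>2 = t * a * (s\<^sup>2 - l * (2 * s - l))"
      by (simp add: power2_eq_square algebra_simps)
    also have "\<dots> \<le> s\<^sup>2 * (t * a)" using True assms by (simp add: algebra_simps)
    also have "\<dots> \<le> s\<^sup>2 * (b * (l - t))" using tb by (intro mult_left_mono) auto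
    also have "\<dots> \<le> max (s\<^sup>2 * b) (t * a * l) * (l - t)"
      using lt mult_right_mono[of "s\<^sup>2 * b" "max (s\<^sup>2 * b) (t * a * l)" "l - t"] by (simp add: mult.assoc)
    finally show ?thesis .
  next
    case False
    have "l * t \<le> l * s" "s * s \<le> s * l" using assms False by (auto intro!: mult_left_mono)
    then have "(l - s)\<^sup>2 \<le> l * (l - t)" by (simp add: power2_eq_square algebra_simps)
    then have "t * a * (l - s)\<^sup>2 \<le> t * a * (l * (l - t))" using assms by (intro mult_left_mono) auto
    also have "\<dots> \<le> max (s\<^sup>2 * b) (t * a * l) * (l - t)"
      using lt mult_right_mono[of "t * a * l" "max (s\<^sup>2 * b) (t * a * l)" "l - t"] by (simp add: mult.assoc)
    finally show ?thesis .
  qed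
qed

text \<open>Minimum and maximum of two numbers add up to their sum, so moving the minimum to the
  left leaves \<open>M\<close> as the weight of the squared norm of \<open>g\<close>. The result is
  a form with cross coefficient \<open>t * a * (l - s)\<close>, whose discriminant is bounded by
  \<open>step_size_discriminant\<close>.\<close>

lemma gradient_form_le:
  fixes g h :: "'a::real_inner"
  assumes "0 < a" "0 < b" "0 < l" "0 < t" "t \<le> s" "t * (a + b) \<le> b * l" "0 < p"
  shows "t\<^sup>2 * (a * p / 2) * (norm h)\<^sup>2 - 1/2 * s\<^sup>2 * (b * p) * (norm g)\<^sup>2
      - t * (a * p) * (l * (1/2 * (norm (h - g))\<^sup>2)) - t * s * (a * p) * (h \<bullet> g)
    \<le> - (1/2 * min (s\<^sup>2 * (b * p)) (t * l * (a * p)) * (norm g)\<^sup>2)"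
proof -
  define M where "M = max (s\<^sup>2 * b) (t * a * l)"
  have M: "0 < M" using assms by (simp add: M_def less_max_iff_disj)
  have "(t * a * (l - s))\<^sup>2 = t * a * (t * a * (l - s)\<^sup>2)" by (simp add: power2_eq_square)
  also have "\<dots> \<le> t * a * (M * (l - t))"
    using step_size_discriminant[OF assms(1-6)] assms unfolding M_def by (intro mult_left_mono) auto
  also have "\<dots> = M * (t * a * (l - t))" by simp
  finally have "2 * (t * a * (l - s)) * (g \<bullet> h) \<le> M * (norm g)\<^sup>2 + t * a * (l - t) * (norm h)\<^sup>2"
    by (rule quadratic_form_le[OF M])
  then have "p * (2 * (t * a * (l - s)) * (g \<bullet> h)) \<le> p * (M * (norm g)\<^sup>2 + t * a * (l - t) * (norm h)\<^sup>2)"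
    using assms(7) by (intro mult_left_mono) auto
  moreover have m: "min (s\<^sup>2 * (b * p)) (t * l * (a * p)) = p * (s\<^sup>2 * b + t * a * l - M)"
  proof -
    have "min (s\<^sup>2 * (b * p)) (t * l * (a * p)) = p * min (s\<^sup>2 * b) (t * a * l)"
      using assms(7) by (simp add: min_mult_distrib_left algebra_simps)
    then show ?thesis by (simp add: M_def min_def max_def)
  qed
  moreover have n: "(norm (h - g))\<^sup>2 = (norm h)\<^sup>2 - 2 * (g \<bullet> h) + (norm g)\<^sup>2"
    unfolding power2_norm_eq_inner by (simp add: inner_diff inner_commute)
  ultimately show ?thesis
    unfolding m n inner_commute[of h g] by (simp add: algebra_simps power2_eq_square)
qed

section \<open>Step sizes and the increment of the Lyapunov function\<close>

lemma step_rule: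
  assumes "AdaNAG f x y z s L"
  obtains c where "0 < c" "c \<le> 1" "ereal (s (k+1)) = min (ereal (c * s k))
     (ereal (weight k / (alpha (k+1) + weight k)) * (1 / L (k+1)))"
proof (cases "k = 0")
  case False
  then obtain j where j: "k = Suc j" by (cases k) auto
  show thesis
  proof (rule that)
    show "0 < alpha k / alpha (k+1)" by (simp add: alpha_pos_all)
    show "alpha k / alpha (k+1) \<le> 1"
      using alpha_tilde_mono[of k] alpha_tilde_pos[of "Suc k"] j by (simp add: alpha_eq_tilde)
    show "ereal (s (k+1)) = min (ereal (alpha k / alpha (k+1) * s k))
     (ereal (weight k / (alpha (k+1) + weight k)) * (1 / L (k+1)))"
      using assms False by (simp add: AdaNAG_def weight_def)
  qed
next
  case True
  \<comment> \<open>This reduces the first step ratio to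
    \<open>alpha 0 / (alpha 1 * theta 2)\<close>, to which \<open>alpha_0_bounds\<close>
    applies.\<close>
  have th: "theta 3 * (theta 3 - 1) = (theta 2)\<^sup>2"
    using theta_Suc_quadratic[of 2] by (simp add: eval_nat_numeral)
  have p: "0 < alpha_tilde 1" "0 < alpha_tilde 2" "0 < alpha_tilde 3" by (rule alpha_tilde_pos)+
  have t2: "0 < theta 2" using theta_numeric_bounds(1) by simp
  have "1 / weight 0 = 1 / alpha_tilde 3 + 1 / (alpha_tilde 2)\<^sup>2 - 1 / alpha_tilde 1"
    unfolding weight_0_eq by (simp add: divide_simps)
  \<comment> \<open>This identity is the purpose of the choice of \<open>alpha 0\<close>: it turns
    the special curvature factor of the first step into the general one.\<close>
  then have i: "1 / weight 0 + 1 / alpha_tilde 1 = 1 / alpha_tilde 3 + 1 / (alpha_tilde 2)\<^sup>2"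
    by simp
  have "alpha_tilde 1 * (1 / weight 0 + 1 / alpha_tilde 1) = (alpha_tilde 1 + weight 0) / weight 0"
    using p weight_pos[of 0] by (simp add: field_simps)
  then have "weight 0 / (alpha_tilde 1 + weight 0) = 1 / (alpha_tilde 1 * (1 / weight 0 + 1 / alpha_tilde 1))"
    by simp
  also have "\<dots> = (alpha_tilde 2)\<^sup>2 * alpha_tilde 3 / (alpha_tilde 3 + (alpha_tilde 2)\<^sup>2) * (1 / alpha_tilde 1)"
    unfolding i using p by (simp add: divide_simps add_pos_pos)
  finally have w: "(alpha 2)\<^sup>2 * alpha 3 / (alpha 3 + (alpha 2)\<^sup>2) * (1 / alpha 1)
      = weight 0 / (alpha 1 + weight 0)" by (simp add: alpha_eq_tilde)
  show thesis
  proof (rule that)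
    show "0 < alpha 0 / alpha 1 * (theta 2 / (theta 3 * (theta 3 - 1)))"
      unfolding th using p t2 alpha_0_bounds(1) by (simp add: alpha_eq_tilde)
    show "alpha 0 / alpha 1 * (theta 2 / (theta 3 * (theta 3 - 1))) \<le> 1"
      unfolding th using p t2 alpha_0_bounds(2) by (simp add: alpha_eq_tilde field_simps power2_eq_square)
    show "ereal (s (k+1)) = min (ereal (alpha 0 / alpha 1 * (theta 2 / (theta 3 * (theta 3 - 1))) * s k))
     (ereal (weight k / (alpha (k+1) + weight k)) * (1 / L (k+1)))"
      using assms True unfolding AdaNAG_def w by simp
  qed
qed

text \<open>The recursion for \<open>theta\<close> exposes the factor that \<open>B_coeff k\<close>
  shares with \<open>A_coeff k\<close>.\<close>

lemma B_coeff_eq: "B_coeff k = weight k * (theta (k+3) * (theta (k+3) - 1))"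
  using theta_Suc_quadratic[of "k+2"] by (simp add: B_coeff_def weight_def eval_nat_numeral)

lemma alpha_Suc_theta: "2 * alpha (k+1) * theta (k+3) = theta (k+3) - 1"
  using theta_ge_1[of "k+3"] by (simp add: alpha_eq_tilde alpha_tilde_def field_simps eval_nat_numeral)

text \<open>The curvature is zero or a positive real, so its inverse is positive, possibly infinite.
  Hence both entries of the minimum in \<open>step_rule\<close> stay positive, and
  \<open>c \<le> 1\<close> gives monotonicity.\<close>

lemma step_bounds:
  fixes f :: "'a::euclidean_space \<Rightarrow> real"
  assumes "\<And>w. f differentiable (at w)" "convex_on UNIV f" "AdaNAG f x y z s L"
  shows "0 < s k" "s (k+1) \<le> s k"
proof -
  have *: "0 < s (k+1) \<and> s (k+1) \<le> s k" if s: "0 < s k" for k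
  proof -
    obtain c where c: "0 < c" "c \<le> 1" "ereal (s (k+1)) = min (ereal (c * s k))
        (ereal (weight k / (alpha (k+1) + weight k)) * (1 / L (k+1)))"
      by (rule step_rule[OF assms(3)])
    have "0 < weight k / (alpha (k+1) + weight k)"
      using weight_pos[of k] alpha_pos_all[of "k+1"] by simp
    moreover have "1 / L (k+1) > 0"
    proof -
      have "L (k+1) = local_curvature f (x k) (x (k+1))" using assms(3) by (simp add: AdaNAG_def)
      then show ?thesis
        by (cases rule: local_curvature_cases[OF assms(1,2), of "x k" "x (k+1)"])
           (auto simp: divide_ereal_def one_ereal_def)
    qed
    ultimately have "0 < ereal (weight k / (alpha (k+1) + weight k)) * (1 / L (k+1))"
      by (simp add: ereal_zero_less_0_iff)
    then have "0 < ereal (s (k+1))" using c s by simp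
    moreover have "ereal (s (k+1)) \<le> ereal (c * s k)" using c(3) by simp
    moreover have "c * s k \<le> 1 * s k" using c(2) s by (intro mult_right_mono) auto
    ultimately show ?thesis by simp
  qed
  have pos: "0 < s k" for k
  proof (induction k)
    case 0
    then show ?case using assms(3) by (simp add: AdaNAG_def)
  next
    case (Suc k)
    then show ?case using *[of k] by simp
  qed
  from pos show "0 < s k" .
  from *[OF pos] show "s (k+1) \<le> s k" by simp
qed

text \<open>The function values at the two iterates and at the minimizer survive only in the
  convexity gap \<open>D\<close>, which is kept exact so that the curvature can be inserted
  later.\<close>

lemma lyapunov_increment_le:
  fixes f :: "'a::euclidean_space \<Rightarrow> real" and k :: nat
  assumes diff: "\<And>w. f differentiable (at w)" and conv: "convex_on UNIV f"
    and xmin: "\<And>u. f xstar \<le> f u" and ada: "AdaNAG f x y z s L"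
  defines "g \<equiv> gradient f (x k)" and "h \<equiv> gradient f (x (k+1))"
  defines "D \<equiv> f (x k) - f (x (k+1)) - h \<bullet> (x k - x (k+1))"
  shows "lyapunov f xstar x z s (k+1) - lyapunov f xstar x z s k
    \<le> (s (k+1))\<^sup>2 * (A_coeff k / 2) * (norm h)\<^sup>2 - 1/2 * (s k)\<^sup>2 * B_coeff k * (norm g)\<^sup>2
      - s (k+1) * A_coeff k * D - s (k+1) * s k * A_coeff k * (h \<bullet> g)"
proof -
  define a where "a = alpha (k+1)"
  define \<theta> where "\<theta> = theta (k+3)"
  define t where "t = s (k+1)"
  define F where "F = f (x (k+1)) - f xstar"
  have pos: "0 < a" "0 < t" "1 \<le> \<theta>" "0 \<le> F"
    using alpha_pos_all step_bounds(1)[OF diff conv ada] theta_ge_1 xmin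
    by (auto simp: a_def t_def \<theta>_def F_def)
  have A: "A_coeff k = a * (\<theta> * (\<theta> - 1))" by (simp add: A_coeff_def a_def \<theta>_def)
  have a\<theta>: "2 * (a * \<theta>)\<^sup>2 = A_coeff k"
  proof -
    have "2 * (a * \<theta>)\<^sup>2 = a * \<theta> * (2 * a * \<theta>)" by (simp add: power2_eq_square)
    also have "2 * a * \<theta> = \<theta> - 1" using alpha_Suc_theta[of k] by (simp only: a_def \<theta>_def)
    finally show ?thesis by (simp add: A)
  qed
  have B: "B_coeff (k+1) = (a * \<theta>)\<^sup>2"
    by (simp add: B_coeff_def a_def \<theta>_def power_mult_distrib eval_nat_numeral)
  have "s (k+2) * A_coeff (k+1) \<le> t * a * \<theta>\<^sup>2"
  proof -
    \<comment> \<open>The index \<open>k+1\<close> is at least 1, so the general step rule applies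
      even for \<open>k = 0\<close>.\<close>
    have "ereal (s (k+2)) \<le> ereal (a / alpha (k+2) * t)"
      using ada unfolding AdaNAG_def a_def t_def
      by (metis Suc_1 add.commute add_Suc_right le_add2 min.cobounded1 plus_1_eq_Suc)
    then have "s (k+2) * alpha (k+2) \<le> a * t"
      using alpha_pos_all[of "k+2"] by (simp add: field_simps)
    moreover have "theta (k+4) * (theta (k+4) - 1) = \<theta>\<^sup>2"
      using theta_Suc_quadratic[of "k+3"] by (simp add: \<theta>_def eval_nat_numeral)
    moreover have "A_coeff (k+1) = alpha (k+2) * (theta (k+4) * (theta (k+4) - 1))"
      by (simp add: A_coeff_def eval_nat_numeral)
    ultimately show ?thesis
      using mult_right_mono[of "s (k+2) * alpha (k+2)" "a * t" "\<theta>\<^sup>2"] by (simp add: mult_ac)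
  qed
  then have VF: "s (k+2) * A_coeff (k+1) * F \<le> t * a * \<theta>\<^sup>2 * F"
    using pos by (intro mult_right_mono)
  have z1: "z (k+1) = x (k+1) + (\<theta> - 1) *\<^sub>R (x (k+1) - x k + s k *\<^sub>R g)"
  proof -
    have "x (k+1) = (1 - 1 / \<theta>) *\<^sub>R (x k - s k *\<^sub>R g) + (1 / \<theta>) *\<^sub>R z (k+1)"
      using ada by (simp add: AdaNAG_def \<theta>_def g_def)
    then have "\<theta> *\<^sub>R x (k+1) = (\<theta> * (1 - 1 / \<theta>)) *\<^sub>R (x k - s k *\<^sub>R g) + (\<theta> * (1 / \<theta>)) *\<^sub>R z (k+1)"
      by (metis scaleR_add_right scaleR_scaleR)
    moreover have "\<theta> * (1 - 1 / \<theta>) = \<theta> - 1" "\<theta> * (1 / \<theta>) = 1"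
      using pos by (auto simp: field_simps)
    ultimately show ?thesis by (simp add: algebra_simps)
  qed
  have z2: "z (k+2) = z (k+1) - (t * a * \<theta>) *\<^sub>R h"
  proof -
    have "\<forall>j. z (j+1) = z j - (s j * alpha j * theta (j+2)) *\<^sub>R gradient f (x j)"
      using ada by (simp add: AdaNAG_def)
    from this[rule_format, of "k+1"] show ?thesis
      by (simp add: t_def a_def \<theta>_def h_def eval_nat_numeral)
  qed
  have "(norm (z (k+2) - xstar))\<^sup>2
      = (norm (z (k+1) - xstar - (t * a * \<theta>) *\<^sub>R h))\<^sup>2"
    unfolding z2 by (simp add: diff_diff_eq add.commute)
  also have "\<dots> = (norm (z (k+1) - xstar))\<^sup>2 - 2 * (t * a * \<theta>) * (h \<bullet> (z (k+1) - xstar))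
      + (t * a * \<theta>)\<^sup>2 * (norm h)\<^sup>2"
    unfolding power2_norm_eq_inner
    by (simp add: inner_diff_left inner_diff_right inner_commute power2_eq_square algebra_simps)
  finally have Z: "(norm (z (k+2) - xstar))\<^sup>2 - (norm (z (k+1) - xstar))\<^sup>2
      = t\<^sup>2 * (a * \<theta>)\<^sup>2 * (norm h)\<^sup>2 - 2 * (t * a * \<theta>) * (h \<bullet> (z (k+1) - xstar))"
    by (simp add: power_mult_distrib)
  \<comment> \<open>Convexity towards the minimizer supplies one copy of \<open>F\<close>; the
    momentum part of \<open>z1\<close> supplies another \<open>\<theta> - 1\<close> copies, so
    \<open>\<theta>\<close> in total.\<close>
  have "F \<le> h \<bullet> (x (k+1) - xstar)"
    using convex_gradient_inequality[OF diff conv, of "x (k+1)" xstar]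
    by (simp add: F_def h_def inner_diff_right)
  then have "F + (\<theta> - 1) * (h \<bullet> (x (k+1) - x k)) + (\<theta> - 1) * s k * (h \<bullet> g) \<le> h \<bullet> (z (k+1) - xstar)"
    unfolding z1 by (simp add: algebra_simps)
  moreover have "h \<bullet> (x (k+1) - x k) = F - (f (x k) - f xstar) + D"
    by (simp add: D_def F_def inner_diff_right)
  ultimately have "t * a * \<theta> * (F + (\<theta> - 1) * (F - (f (x k) - f xstar) + D) + (\<theta> - 1) * s k * (h \<bullet> g))
      \<le> t * a * \<theta> * (h \<bullet> (z (k+1) - xstar))"
    using pos by (intro mult_left_mono) auto
  then have I: "t * a * \<theta>\<^sup>2 * F - t * A_coeff k * (f (x k) - f xstar) + t * A_coeff k * D
        + t * s k * A_coeff k * (h \<bullet> g) \<le> t * a * \<theta> * (h \<bullet> (z (k+1) - xstar))"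
    unfolding A by (simp add: algebra_simps power2_eq_square)
  have k2: "k + 1 + 1 = k + 2" by simp
  have "lyapunov f xstar x z s (k+1) - lyapunov f xstar x z s k
     = s (k+2) * A_coeff (k+1) * F - t * A_coeff k * (f (x k) - f xstar)
      + 1/2 * (t\<^sup>2 * (a * \<theta>)\<^sup>2 * (norm h)\<^sup>2) - 1/2 * (s k)\<^sup>2 * B_coeff k * (norm g)\<^sup>2
      + 1/2 * ((norm (z (k+2) - xstar))\<^sup>2 - (norm (z (k+1) - xstar))\<^sup>2)"
    unfolding lyapunov_def B k2 F_def t_def g_def h_def by (simp add: algebra_simps)
  \<comment> \<open>The squared norm of \<open>h\<close> collects two equal halves, one from
    \<open>B_coeff (k+1)\<close> and one from the squared distance of \<open>z\<close>.\<close>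
  also have "\<dots> \<le> t\<^sup>2 * (a * \<theta>)\<^sup>2 * (norm h)\<^sup>2 - 1/2 * (s k)\<^sup>2 * B_coeff k * (norm g)\<^sup>2
      - t * A_coeff k * D - t * s k * A_coeff k * (h \<bullet> g)"
    unfolding Z using VF I by (simp add: algebra_simps)
  also have "t\<^sup>2 * (a * \<theta>)\<^sup>2 * (norm h)\<^sup>2 = t\<^sup>2 * (A_coeff k / 2) * (norm h)\<^sup>2"
    by (simp add: a\<theta>[symmetric])
  finally show ?thesis by (simp add: t_def)
qed

theorem theorem2:
  fixes f :: "real ^ 'd::finite \<Rightarrow> real"
    and xstar :: "real ^ 'd"
    and x y z :: "nat \<Rightarrow> real ^ 'd"
    and s :: "nat \<Rightarrow> real"
    and L :: "nat \<Rightarrow> ereal"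
  assumes "locally_smooth f"
    and "convex_on UNIV f"
    and "\<forall>u. f xstar \<le> f u"
    and "AdaNAG f x y z s L"
  defines "V \<equiv> lyapunov f xstar x z s"
  defines "bound \<equiv> \<lambda>k. - (ereal (1/2)
      * min (ereal ((s k)\<^sup>2 * B_coeff k))
            (ereal (s (k+1)) / L (k+1) * ereal (A_coeff k))
      * ereal ((norm (gradient f (x k)))\<^sup>2))"
  shows "\<forall>k. ereal (V (k+1) - V k) \<le> bound k \<and> bound k \<le> 0"
proof
  fix k
  have diff: "\<And>w. f differentiable (at w)" using assms(1) by (simp add: locally_smooth_def)
  note conv = assms(2) and ada = assms(4)
  define g where "g = gradient f (x k)"
  define h where "h = gradient f (x (k+1))"
  define D where "D = f (x k) - f (x (k+1)) - h \<bullet> (x k - x (k+1))"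
  define a where "a = alpha (k+1)"
  define p where "p = theta (k+3) * (theta (k+3) - 1)"
  define t where "t = s (k+1)"
  have p: "0 < p" using theta_Suc_gt_1[of "k+2"] by (simp add: p_def eval_nat_numeral)
  have pos: "0 < a" "0 < weight k" "0 < s k" "0 < t" "t \<le> s k"
    using alpha_pos_all weight_pos step_bounds[OF diff conv ada] by (simp_all add: a_def t_def)
  have A: "A_coeff k = a * p" by (simp add: A_coeff_def a_def p_def)
  have B: "B_coeff k = weight k * p" by (simp add: B_coeff_eq p_def)
  have AB: "0 < A_coeff k" "0 < B_coeff k" using pos p by (simp_all add: A B)
  have incr: "V (k+1) - V k \<le> t\<^sup>2 * (a * p / 2) * (norm h)\<^sup>2 - 1/2 * (s k)\<^sup>2 * (weight k * p) * (norm g)\<^sup>2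
      - t * (a * p) * D - t * s k * (a * p) * (h \<bullet> g)"
    using lyapunov_increment_le[OF diff conv _ ada, of xstar k] assms(3)
    unfolding V_def A B D_def g_def h_def t_def by blast
  have L: "L (k+1) = local_curvature f (x k) (x (k+1))" using ada by (simp add: AdaNAG_def)
  show "ereal (V (k+1) - V k) \<le> bound k \<and> bound k \<le> 0"
  proof (cases rule: local_curvature_cases[OF diff conv, of "x k" "x (k+1)"])
    case 1
    then have hg: "h = g" by (simp add: h_def g_def)
    \<comment> \<open>Zero curvature makes this quotient infinite, so the minimum in
      \<open>bound\<close> is its first entry.\<close>
    have "ereal t / L (k+1) * ereal (A_coeff k) = \<infinity>"
      using 1 L pos AB by (simp add: divide_ereal_def)
    then have bound: "bound k = ereal (- (1/2 * ((s k)\<^sup>2 * B_coeff k) * (norm g)\<^sup>2))"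
      by (simp add: bound_def g_def t_def)
    have "0 \<le> D" using convex_gradient_inequality[OF diff conv, of "x (k+1)" "x k"]
      by (simp add: D_def h_def)
    then have "0 \<le> t * (a * p) * D" using pos p by simp
    \<comment> \<open>As the gradients coincide, the cross term is a multiple of the squared norm
      and absorbs the positive term because \<open>t \<le> s k\<close>.\<close>
    moreover have "t\<^sup>2 * (a * p / 2) * (norm g)\<^sup>2 \<le> t * s k * (a * p) * (g \<bullet> g)"
    proof -
      have "t * t \<le> t * s k" using pos by (intro mult_left_mono) auto
      then have "t\<^sup>2 * (a * p) * (norm g)\<^sup>2 \<le> t * s k * (a * p) * (norm g)\<^sup>2"
        using pos p by (intro mult_right_mono) (auto simp: power2_eq_square)
      moreover have "0 \<le> t\<^sup>2 * (a * p) * (norm g)\<^sup>2" using pos p by simp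
      ultimately show ?thesis by (simp add: power2_norm_eq_inner[symmetric])
    qed
    ultimately have "V (k+1) - V k \<le> - (1/2 * ((s k)\<^sup>2 * B_coeff k) * (norm g)\<^sup>2)"
      using incr unfolding hg B by linarith
    then show ?thesis unfolding bound using AB by simp
  next
    case (2 r)
    define l where "l = 1 / r"
    have l: "0 < l" using 2 by (simp add: l_def)
    have "ereal t / L (k+1) * ereal (A_coeff k) = ereal (t * l * (a * p))"
      using 2 L by (simp add: A l_def)
    then have bound: "bound k = ereal (- (1/2 * min ((s k)\<^sup>2 * (weight k * p)) (t * l * (a * p)) * (norm g)\<^sup>2))"
      by (simp add: bound_def g_def t_def B flip: ereal_min)
    have D: "D = l * (1/2 * (norm (h - g))\<^sup>2)"
      using 2 by (simp add: D_def h_def g_def l_def)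
    \<comment> \<open>The second entry of the step-size minimum, cleared of its denominator, is the
      curvature hypothesis of \<open>gradient_form_le\<close>.\<close>
    have "ereal t \<le> ereal (weight k / (a + weight k)) * (1 / L (k+1))"
      by (rule step_rule[OF ada, of k]) (simp add: t_def a_def)
    also have "\<dots> = ereal (weight k / (a + weight k) * l)"
      using 2 L by (simp add: l_def one_ereal_def)
    finally have "t \<le> weight k * l / (a + weight k)" by simp
    moreover have "0 < a + weight k" using pos by simp
    ultimately have "t * (a + weight k) \<le> weight k * l" by (simp add: pos_le_divide_eq)
    from gradient_form_le[OF pos(1,2) l pos(4,5) this p, of h g] incr
    have "V (k+1) - V k \<le> - (1/2 * min ((s k)\<^sup>2 * (weight k * p)) (t * l * (a * p)) * (norm g)\<^sup>2)"
      unfolding D by linarith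
    moreover have "0 \<le> min ((s k)\<^sup>2 * (weight k * p)) (t * l * (a * p))"
      using pos l p by simp
    ultimately show ?thesis unfolding bound by simp
  qed
qed

end
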